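(* Suppose $G$ is Hermitian, and let $D$ denote a nonnegative, diagonal matrix with $\operatorname{trace}(D^2) = 1$. The factorization $G = DTD$ satisfies $\|T\| \leq \alpha$ if and only if $D$ satisfies $$\lambda_{\max}\begin{bmatrix} -\alpha D^2 & G \\ G & -\alpha D^2 \end{bmatrix} \leq 0.$$ In particular, if no $D$ verifies this bound, then no factorization $G = DTD$ admits $\|T\| \leq \alpha$.
   Context: Matrices are real or complex, and $\alpha$ is a real scalar. Throughout, the letter $D$ is reserved for nonnegative, diagonal matrices with $\operatorname{trace}(D^2)=1$ (of the same size as $G$). $\|\cdot\|$ is the spectral norm and $\lambda_{\max}$ denotes the algebraically maximal eigenvalue of a Hermitian matrix. *)

theory Defs
  imports "HOL-Analysis.Analysis"
begin

text \<open>Matrices are real or complex. Notions that do not involve conjugation are defined for all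
  real normed fields and are only used for the two fields \<^typ>\<open>real\<close> and \<^typ>\<open>complex\<close>.\<close>

definition conj_transpose :: "complex^'n^'m \<Rightarrow> complex^'m^'n" where
  "conj_transpose A = map_matrix cnj (transpose A)"

definition hermitian :: "complex^'n^'n \<Rightarrow> bool" where
  "hermitian A \<longleftrightarrow> conj_transpose A = A"

text \<open>The norm on \<^typ>\<open>complex^'n\<close> and \<^typ>\<open>real^'n\<close> is the Euclidean one.\<close>

definition spectral_norm :: "'a::real_normed_field^'n^'m \<Rightarrow> real" where
  "spectral_norm A = onorm (\<lambda>v. A *v v)"

definition real_eigenvalues :: "'a::real_normed_field^'n^'n \<Rightarrow> real set" where
  "real_eigenvalues A = {l. \<exists>v. v \<noteq> 0 \<and> A *v v = of_real l *s v}"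

text \<open>Meant for Hermitian (real symmetric) matrices only: their eigenvalues are all real, and the
  set of eigenvalues is finite and nonempty, so that \<^const>\<open>Max\<close> is meaningful.\<close>

definition lambda_max :: "'a::real_normed_field^'n^'n \<Rightarrow> real" where
  "lambda_max A = Max (real_eigenvalues A)"

definition block_matrix ::
  "'a^'n^'m \<Rightarrow> 'a^'q^'m \<Rightarrow> 'a^'n^'p \<Rightarrow> 'a^'q^'p \<Rightarrow> 'a^('n + 'q)^('m + 'p)" where
  "block_matrix A B C E = (\<chi> i j.
     case i of
       Inl r \<Rightarrow> (case j of Inl s \<Rightarrow> A $ r $ s | Inr s \<Rightarrow> B $ r $ s)
     | Inr r \<Rightarrow> (case j of Inl s \<Rightarrow> C $ r $ s | Inr s \<Rightarrow> E $ r $ s))"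

text \<open>The matrices for which the letter \<open>D\<close> is reserved.\<close>

definition unit_nonneg_diagonal :: "'a::real_normed_field^'n^'n \<Rightarrow> bool" where
  "unit_nonneg_diagonal D \<longleftrightarrow>
     (\<forall>i j. i \<noteq> j \<longrightarrow> D $ i $ j = 0) \<and> (\<forall>i. D $ i $ i \<in> \<real>\<^sub>\<ge>\<^sub>0) \<and> trace (D ** D) = 1"

definition bound_matrix ::
  "real \<Rightarrow> 'a::real_normed_field^'n^'n \<Rightarrow> 'a^'n^'n \<Rightarrow> 'a^('n + 'n)^('n + 'n)" where
  "bound_matrix \<alpha> D G = block_matrix (- (\<alpha> *\<^sub>R (D ** D))) G G (- (\<alpha> *\<^sub>R (D ** D)))"

end

theory Submission
  imports Defs
begin

text \<open>
  Write \<open>M\<close> for the block matrix in the bound. Its quadratic form at a pair \<open>(x, y)\<close> is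
  \<open>2 \<langle>G y, x\<rangle> - \<alpha> (\<parallel>D x\<parallel>\<^sup>2 + \<parallel>D y\<parallel>\<^sup>2)\<close>, and the largest eigenvalue of \<open>M\<close> is nonpositive
  iff this form is nowhere positive. Both directions compare the form with the norm of \<open>T\<close>.

  If \<open>G = D T D\<close>, then \<open>\<langle>G y, x\<rangle> = \<langle>T D y, D x\<rangle> \<le> \<alpha> \<parallel>D x\<parallel> \<parallel>D y\<parallel>\<close>, and the form is nonpositive by
  the inequality between the arithmetic and geometric means.

  Conversely, let the form be nonpositive. For invertible \<open>D\<close> one takes \<open>T = D\<^sup>-\<^sup>1 G D\<^sup>-\<^sup>1\<close> and
  substitutes \<open>D\<^sup>-\<^sup>1 x\<close>, \<open>D\<^sup>-\<^sup>1 y\<close>. But \<open>D\<close> may have zeros on the diagonal, and then \<open>D\<^sup>-\<^sup>1\<close> is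
  replaced by the Moore-Penrose inverse \<open>E\<close>. That \<open>T = E G E\<close> still factors \<open>G\<close> is due to
  semidefiniteness: if \<open>D x = 0\<close>, then the form of \<open>M\<close> vanishes at \<open>(x, 0)\<close>, which forces
  \<open>M (x, 0) = 0\<close> and hence \<open>G x = 0\<close> (lemma \<open>nonneg_form_null_vector\<close>).

  The argument uses only real inner products. On \<^typ>\<open>complex^'n\<close> the inner product is the real
  part of the Hermitian one, a Hermitian matrix acts as a real-linear self-adjoint map, and its
  eigenvalues in the sense of \<^const>\<open>real_eigenvalues\<close> are those of this map. So the real and the
  complex case are instances of one statement over a normed field that is also a Euclidean space
  (lemma \<open>factorization_bound_iff\<close>).
\<close>

section \<open>Self-adjoint maps of a Euclidean space\<close>

lemma nonneg_quadratic_zero_slope: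
  fixes a b :: real
  assumes nonneg: "\<And>t. 0 \<le> 2 * t * a + t\<^sup>2 * b"
  shows "a = 0"
proof (rule ccontr)
  assume "a \<noteq> 0"
  define c where "c = \<bar>b\<bar> + 1"
  have "c > 0" "b < 2 * c" by (auto simp: c_def)
  \<comment> \<open>At \<open>t = - a / c\<close> the linear term exceeds the quadratic one, since \<open>b < 2 c\<close>.\<close>
  have "2 * (- a / c) * a + (- a / c)\<^sup>2 * b = (a\<^sup>2 / c\<^sup>2) * (b - 2 * c)"
    using \<open>c > 0\<close> by (simp add: field_simps power2_eq_square)
  also have "\<dots> < 0"
    using \<open>a \<noteq> 0\<close> \<open>c > 0\<close> \<open>b < 2 * c\<close> by (intro mult_pos_neg) auto
  finally show False using nonneg[of "- a / c"] by simp
qed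

text \<open>A nonnegative quadratic form has a minimum at each of its zeros, so its derivative
  there, which is \<open>2 (h u)\<close>, vanishes.\<close>

lemma nonneg_form_null_vector:
  fixes h :: "'a::real_inner \<Rightarrow> 'a"
  assumes lin: "linear h"
    and sa: "\<And>v w. h v \<bullet> w = v \<bullet> h w"
    and nonneg: "\<And>v. 0 \<le> h v \<bullet> v"
    and null: "h u \<bullet> u = 0"
  shows "h u = 0"
proof -
  have "0 \<le> 2 * t * (h u \<bullet> h u) + t\<^sup>2 * (h (h u) \<bullet> h u)" for t
  proof -
    have "h (u + t *\<^sub>R h u) \<bullet> (u + t *\<^sub>R h u) =
        h u \<bullet> u + 2 * t * (h u \<bullet> h u) + t\<^sup>2 * (h (h u) \<bullet> h u)"
      using sa[of "h u" u]
      by (simp add: linear_add[OF lin] linear_scale[OF lin] inner_add_left inner_add_right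
          power2_eq_square algebra_simps)
    with nonneg[of "u + t *\<^sub>R h u"] null show ?thesis by simp
  qed
  from nonneg_quadratic_zero_slope[OF this] show ?thesis by simp
qed

text \<open>A maximizer of the Rayleigh quotient is an eigenvector for the maximum \<open>m\<close>: it is a zero of
  the nonnegative form of \<open>m - f\<close>.\<close>

lemma self_adjoint_top_eigenvector:
  fixes f :: "'a::euclidean_space \<Rightarrow> 'a"
  assumes lin: "linear f" and sa: "\<And>v w. f v \<bullet> w = v \<bullet> f w"
  obtains m u where "u \<noteq> 0" "f u = m *\<^sub>R u" "\<And>v. f v \<bullet> v \<le> m * (v \<bullet> v)"
proof -
  have "sphere (0::'a) 1 \<noteq> {}" by simp
  moreover have "continuous_on (sphere 0 1) (\<lambda>v. f v \<bullet> v)"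
    by (intro continuous_intros linear_continuous_on) (use lin linear_conv_bounded_linear in blast)
  ultimately obtain u where u: "u \<in> sphere 0 1"
    and max: "\<And>v. v \<in> sphere 0 1 \<Longrightarrow> f v \<bullet> v \<le> f u \<bullet> u"
    using continuous_attains_sup[of "sphere 0 1" "\<lambda>v. f v \<bullet> v"] by auto
  define m where "m = f u \<bullet> u"
  have bound: "f v \<bullet> v \<le> m * (v \<bullet> v)" for v
  proof (cases "v = 0")
    case False
    have "(1 / norm v) *\<^sub>R v \<in> sphere 0 1" using False by simp
    from max[OF this] have "(f v \<bullet> v) / (norm v)\<^sup>2 \<le> m"
      by (simp add: m_def linear_scale[OF lin] power2_eq_square)
    with False show ?thesis by (simp add: field_simps power2_norm_eq_inner)
  qed (simp add: linear_0[OF lin])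
  define h where "h v = m *\<^sub>R v - f v" for v
  have "h u = 0"
  proof (rule nonneg_form_null_vector[of h])
    show "linear h"
      using linear_compose_sub[OF linear_scaleR[of m] lin] by (simp add: h_def[abs_def])
    show "h v \<bullet> w = v \<bullet> h w" for v w
      by (simp add: h_def inner_diff_left inner_diff_right sa)
    show "0 \<le> h v \<bullet> v" for v
      using bound[of v] by (simp add: h_def inner_diff_left)
    show "h u \<bullet> u = 0"
      using u by (simp add: h_def inner_diff_left m_def norm_eq_1)
  qed
  then have "f u = m *\<^sub>R u" by (simp add: h_def)
  moreover have "u \<noteq> 0" using u by auto
  ultimately show thesis using bound that by blast
qed

text \<open>Eigenvectors for distinct eigenvalues are orthogonal, hence linearly independent.\<close>

lemma self_adjoint_finite_eigenvalues:
  fixes f :: "'a::euclidean_space \<Rightarrow> 'a"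
  assumes sa: "\<And>v w. f v \<bullet> w = v \<bullet> f w"
  shows "finite {l. \<exists>v. v \<noteq> 0 \<and> f v = l *\<^sub>R v}" (is "finite ?S")
proof -
  obtain e where e: "\<And>l. l \<in> ?S \<Longrightarrow> e l \<noteq> 0 \<and> f (e l) = l *\<^sub>R e l"
    using bchoice[of ?S "\<lambda>l v. v \<noteq> 0 \<and> f v = l *\<^sub>R v"] by blast
  have orth: "e l \<bullet> e k = 0" if "l \<in> ?S" "k \<in> ?S" "l \<noteq> k" for l k
  proof -
    have "l * (e l \<bullet> e k) = k * (e l \<bullet> e k)"
      using sa[of "e l" "e k"] e[OF that(1)] e[OF that(2)] by simp
    with \<open>l \<noteq> k\<close> show ?thesis by simp
  qed
  have "inj_on e ?S"
  proof (rule inj_onI, rule ccontr)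
    fix l k assume "l \<in> ?S" "k \<in> ?S" "e l = e k" "l \<noteq> k"
    with orth[of l k] e[of l] show False by auto
  qed
  moreover have "finite (e ` ?S)"
  proof -
    have "pairwise orthogonal (e ` ?S)"
      using orth unfolding pairwise_def orthogonal_def by blast
    moreover have "0 \<notin> e ` ?S" using e by force
    ultimately have "independent (e ` ?S)"
      by (rule pairwise_orthogonal_independent)
    then show ?thesis by (rule independent_imp_finite)
  qed
  ultimately show ?thesis using finite_imageD by blast
qed

section \<open>Matrices that act self-adjointly\<close>

text \<open>The real inner product is used over every field, so for complex matrices this is the
  Hermitian property stated without conjugation.\<close>

definition acts_self_adjoint :: "'a::{real_normed_field,euclidean_space}^'n^'n \<Rightarrow> bool" where
  "acts_self_adjoint A \<longleftrightarrow> (\<forall>v w. (A *v v) \<bullet> w = v \<bullet> (A *v w))"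

lemma acts_self_adjointD:
  "acts_self_adjoint A \<Longrightarrow> (A *v v) \<bullet> w = v \<bullet> (A *v w)"
  by (simp add: acts_self_adjoint_def)

lemma matrix_action_linear:
  fixes A :: "'a::{real_normed_field,euclidean_space}^'n^'m"
  shows "linear ((*v) A)"
  by (rule linearI)
    (simp_all add: matrix_vector_mult_def vec_eq_iff algebra_simps sum.distrib scaleR_sum_right)

lemma acts_self_adjoint_entrywise:
  fixes A :: "'a::{real_normed_field,euclidean_space}^'n^'n"
  assumes "\<And>i j x y. (A $ i $ j * x) \<bullet> y = x \<bullet> (A $ j $ i * y)"
  shows "acts_self_adjoint A"
  unfolding acts_self_adjoint_def
proof (intro allI)
  fix v w
  have "(A *v v) \<bullet> w = (\<Sum>i\<in>UNIV. \<Sum>j\<in>UNIV. (A $ i $ j * v $ j) \<bullet> w $ i)"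
    by (simp add: inner_vec_def matrix_vector_mult_def inner_sum_left)
  also have "\<dots> = (\<Sum>i\<in>UNIV. \<Sum>j\<in>UNIV. v $ j \<bullet> (A $ j $ i * w $ i))"
    by (simp only: assms)
  also have "\<dots> = (\<Sum>j\<in>UNIV. \<Sum>i\<in>UNIV. v $ j \<bullet> (A $ j $ i * w $ i))"
    by (rule sum.swap)
  also have "\<dots> = v \<bullet> (A *v w)"
    by (simp add: inner_vec_def matrix_vector_mult_def inner_sum_right)
  finally show "(A *v v) \<bullet> w = v \<bullet> (A *v w)" .
qed

lemma hermitian_acts_self_adjoint:
  assumes "hermitian G"
  shows "acts_self_adjoint G"
proof (rule acts_self_adjoint_entrywise)
  fix i j and x y :: complex
  have "conj_transpose G $ j $ i = G $ j $ i"
    using assms by (simp add: hermitian_def)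
  then have "G $ j $ i = cnj (G $ i $ j)"
    by (simp add: conj_transpose_def map_matrix_def transpose_def)
  then show "(G $ i $ j * x) \<bullet> y = x \<bullet> (G $ j $ i * y)"
    by (simp add: inner_complex_def algebra_simps)
qed

lemma symmetric_acts_self_adjoint:
  fixes H :: "real^'n^'n"
  assumes "transpose H = H"
  shows "acts_self_adjoint H"
proof (rule acts_self_adjoint_entrywise)
  fix i j and x y :: real
  have "transpose H $ j $ i = H $ j $ i" using assms by simp
  then show "(H $ i $ j * x) \<bullet> y = x \<bullet> (H $ j $ i * y)"
    by (simp add: transpose_def algebra_simps)
qed

lemma lambda_max_nonpos_iff:
  fixes A :: "'a::{real_normed_field,euclidean_space}^'n^'n"
  assumes "acts_self_adjoint A"
  shows "lambda_max A \<le> 0 \<longleftrightarrow> (\<forall>v. (A *v v) \<bullet> v \<le> 0)"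
proof -
  note sa = acts_self_adjointD[OF assms]
  have scale: "of_real l *s v = l *\<^sub>R v" for l and v :: "'a^'n"
    by (simp add: vec_eq_iff scaleR_conv_of_real[where x = "v $ i" for i])
  have fin: "finite (real_eigenvalues A)"
    unfolding real_eigenvalues_def scale by (rule self_adjoint_finite_eigenvalues) (rule sa)
  obtain m u where u: "u \<noteq> 0" "A *v u = m *\<^sub>R u"
    and top: "\<And>v. (A *v v) \<bullet> v \<le> m * (v \<bullet> v)"
    using self_adjoint_top_eigenvector[of "(*v) A", OF matrix_action_linear sa] by blast
  have m: "m \<in> real_eigenvalues A"
    using u by (auto simp: real_eigenvalues_def scale)
  have "lambda_max A \<le> 0 \<longleftrightarrow> (\<forall>l\<in>real_eigenvalues A. l \<le> 0)"
    unfolding lambda_max_def using fin m by (intro Max_le_iff) auto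
  also have "\<dots> \<longleftrightarrow> (\<forall>v. (A *v v) \<bullet> v \<le> 0)"
  proof
    assume "\<forall>l\<in>real_eigenvalues A. l \<le> 0"
    then have "m \<le> 0" using m by blast
    then have "m * (v \<bullet> v) \<le> 0" for v :: "'a^'n"
      by (simp add: mult_nonpos_nonneg)
    then show "\<forall>v. (A *v v) \<bullet> v \<le> 0" using top order_trans by blast
  next
    assume nonpos: "\<forall>v. (A *v v) \<bullet> v \<le> 0"
    show "\<forall>l\<in>real_eigenvalues A. l \<le> 0"
    proof
      fix l assume "l \<in> real_eigenvalues A"
      then obtain v where v: "v \<noteq> 0" "A *v v = l *\<^sub>R v"
        by (auto simp: real_eigenvalues_def scale)
      have "l * (v \<bullet> v) \<le> 0" using nonpos[rule_format, of v] v by simp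
      moreover have "0 < v \<bullet> v" using v by simp
      ultimately show "l \<le> 0" by (simp add: mult_le_0_iff)
    qed
  qed
  finally show ?thesis .
qed

section \<open>Bounding the norm by the bilinear form\<close>

text \<open>The hypothesis is not homogeneous in \<open>x\<close> and \<open>y\<close> separately. Rescaling both to norm
  \<open>\<parallel>x\<parallel> \<parallel>y\<parallel>\<close> turns the sum of squares into a product, and then \<open>x = T y\<close> gives the bound.\<close>

lemma spectral_norm_le_of_form_bound:
  fixes T :: "'a::{real_normed_field,euclidean_space}^'n^'m"
  assumes form: "\<And>x y. 2 * ((T *v y) \<bullet> x) \<le> \<alpha> * ((norm x)\<^sup>2 + (norm y)\<^sup>2)"
    and "0 \<le> \<alpha>"
  shows "spectral_norm T \<le> \<alpha>"
  unfolding spectral_norm_def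
proof (rule onorm_le)
  fix y
  define x where "x = T *v y"
  show "norm (T *v y) \<le> \<alpha> * norm y"
  proof (cases "norm x = 0 \<or> norm y = 0")
    case True
    then show ?thesis
      using \<open>0 \<le> \<alpha>\<close> linear_0[OF matrix_action_linear[of T]] by (auto simp: x_def)
  next
    case False
    let ?p = "norm x * norm y"
    have "0 < ?p" using False by simp
    have "T *v (norm x *\<^sub>R y) = norm x *\<^sub>R x"
      unfolding x_def by (rule linear_scale[OF matrix_action_linear])
    then have "2 * ((T *v (norm x *\<^sub>R y)) \<bullet> (norm y *\<^sub>R x)) = 2 * ?p * (norm x)\<^sup>2"
      by (simp add: power2_norm_eq_inner)
    moreover have "\<alpha> * ((norm (norm y *\<^sub>R x))\<^sup>2 + (norm (norm x *\<^sub>R y))\<^sup>2) = 2 * ?p * (\<alpha> * ?p)"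
      by (simp add: power2_eq_square algebra_simps)
    ultimately have "2 * ?p * (norm x)\<^sup>2 \<le> 2 * ?p * (\<alpha> * ?p)"
      using form[of "norm x *\<^sub>R y" "norm y *\<^sub>R x"] by linarith
    then have "(norm x)\<^sup>2 \<le> \<alpha> * ?p"
      by (rule mult_left_le_imp_le) (use \<open>0 < ?p\<close> in simp)
    then show ?thesis using False by (simp add: power2_eq_square x_def[symmetric])
  qed
qed

lemma form_bound_of_spectral_norm_le:
  fixes T :: "'a::{real_normed_field,euclidean_space}^'n^'m"
  assumes "spectral_norm T \<le> \<alpha>"
  shows "2 * ((T *v y) \<bullet> x) \<le> \<alpha> * ((norm x)\<^sup>2 + (norm y)\<^sup>2)"
proof -
  have "bounded_linear ((*v) T)"
    using matrix_action_linear linear_conv_bounded_linear by blast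
  then have "norm (T *v y) \<le> spectral_norm T * norm y" and "0 \<le> spectral_norm T"
    unfolding spectral_norm_def by (auto intro: onorm onorm_pos_le)
  with assms have Ty: "norm (T *v y) \<le> \<alpha> * norm y" and "0 \<le> \<alpha>"
    using mult_right_mono[OF assms norm_ge_zero, of y] by linarith+
  have "2 * ((T *v y) \<bullet> x) \<le> 2 * (norm (T *v y) * norm x)"
    using norm_cauchy_schwarz by simp
  also have "\<dots> \<le> 2 * (\<alpha> * norm y * norm x)"
    using Ty by (simp add: mult_right_mono)
  also have "\<dots> = \<alpha> * (2 * norm x * norm y)" by simp
  also have "\<dots> \<le> \<alpha> * ((norm x)\<^sup>2 + (norm y)\<^sup>2)"
    using \<open>0 \<le> \<alpha>\<close> by (intro mult_left_mono sum_squares_bound)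
  finally show ?thesis .
qed

section \<open>The quadratic form of the block matrix\<close>

definition stack :: "'a^'n \<Rightarrow> 'a^'m \<Rightarrow> 'a^('n + 'm)" where
  "stack x y = (\<chi> i. case i of Inl r \<Rightarrow> x $ r | Inr r \<Rightarrow> y $ r)"

lemma stack_cases:
  obtains x y where "v = stack x y"
proof
  show "v = stack (\<chi> i. v $ Inl i) (\<chi> i. v $ Inr i)"
    by (simp add: stack_def vec_eq_iff split: sum.split)
qed

lemma sum_UNIV_Plus:
  fixes g :: "'n::finite + 'm::finite \<Rightarrow> 'b::comm_monoid_add"
  shows "(\<Sum>i\<in>UNIV. g i) = (\<Sum>i\<in>UNIV. g (Inl i)) + (\<Sum>i\<in>UNIV. g (Inr i))"
  by (simp add: UNIV_Plus_UNIV[symmetric] sum.Plus del: UNIV_Plus_UNIV)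

lemma inner_stack: "stack x y \<bullet> stack x' y' = x \<bullet> x' + y \<bullet> y'"
  by (simp add: inner_vec_def sum_UNIV_Plus stack_def)

lemma stack_eq_0_iff: "stack x y = 0 \<longleftrightarrow> x = 0 \<and> y = 0"
  by (auto simp: stack_def vec_eq_iff split: sum.splits)

lemma block_matrix_stack:
  "block_matrix A B C E *v stack x y = stack (A *v x + B *v y) (C *v x + E *v y)"
  by (simp add: vec_eq_iff block_matrix_def stack_def matrix_vector_mult_def sum_UNIV_Plus
      split: sum.split)

lemma bound_matrix_stack:
  fixes D G :: "'a::{real_normed_field,euclidean_space}^'n^'n"
  shows "bound_matrix \<alpha> D G *v stack x y =
    stack (G *v y - \<alpha> *\<^sub>R (D *v (D *v x))) (G *v x - \<alpha> *\<^sub>R (D *v (D *v y)))"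
proof -
  have "(- (\<alpha> *\<^sub>R (D ** D))) *v z = - (\<alpha> *\<^sub>R (D *v (D *v z)))" for z
    unfolding matrix_vector_mul_assoc
    by (simp add: vec_eq_iff matrix_vector_mult_def sum_negf scaleR_sum_right)
  then show ?thesis
    by (simp add: bound_matrix_def block_matrix_stack add.commute)
qed

lemma bound_matrix_acts_self_adjoint:
  fixes D G :: "'a::{real_normed_field,euclidean_space}^'n^'n"
  assumes "acts_self_adjoint D" "acts_self_adjoint G"
  shows "acts_self_adjoint (bound_matrix \<alpha> D G)"
  unfolding acts_self_adjoint_def
proof (intro allI)
  fix v w :: "'a^('n + 'n)"
  obtain x y where v: "v = stack x y" by (rule stack_cases)
  obtain x' y' where w: "w = stack x' y'" by (rule stack_cases)
  show "(bound_matrix \<alpha> D G *v v) \<bullet> w = v \<bullet> (bound_matrix \<alpha> D G *v w)"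
    by (simp add: v w bound_matrix_stack inner_stack inner_diff_left inner_diff_right
        acts_self_adjointD[OF assms(1)] acts_self_adjointD[OF assms(2)])
qed

lemma bound_matrix_form:
  fixes D G :: "'a::{real_normed_field,euclidean_space}^'n^'n"
  assumes D: "acts_self_adjoint D" and G: "acts_self_adjoint G"
  shows "(bound_matrix \<alpha> D G *v stack x y) \<bullet> stack x y =
    2 * ((G *v y) \<bullet> x) - \<alpha> * ((norm (D *v x))\<^sup>2 + (norm (D *v y))\<^sup>2)"
proof -
  have "(D *v (D *v z)) \<bullet> z = (norm (D *v z))\<^sup>2" for z
    by (simp add: acts_self_adjointD[OF D] power2_norm_eq_inner)
  moreover have "(G *v x) \<bullet> y = (G *v y) \<bullet> x"
    by (metis acts_self_adjointD[OF G] inner_commute)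
  ultimately show ?thesis
    by (simp add: bound_matrix_stack inner_stack inner_diff_left algebra_simps)
qed

lemma lambda_max_bound_matrix_nonpos_iff:
  fixes D G :: "'a::{real_normed_field,euclidean_space}^'n^'n"
  assumes "acts_self_adjoint D" "acts_self_adjoint G"
  shows "lambda_max (bound_matrix \<alpha> D G) \<le> 0 \<longleftrightarrow>
    (\<forall>x y. 2 * ((G *v y) \<bullet> x) \<le> \<alpha> * ((norm (D *v x))\<^sup>2 + (norm (D *v y))\<^sup>2))"
proof -
  have "lambda_max (bound_matrix \<alpha> D G) \<le> 0 \<longleftrightarrow>
      (\<forall>v. (bound_matrix \<alpha> D G *v v) \<bullet> v \<le> 0)"
    using assms by (intro lambda_max_nonpos_iff bound_matrix_acts_self_adjoint)
  also have "\<dots> \<longleftrightarrow> (\<forall>x y. (bound_matrix \<alpha> D G *v stack x y) \<bullet> stack x y \<le> 0)"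
    by (metis stack_cases)
  finally show ?thesis
    by (simp add: bound_matrix_form[OF assms])
qed

text \<open>The form of the negative semidefinite block matrix is \<open>- \<alpha> \<parallel>D x\<parallel>\<^sup>2 = 0\<close> at \<open>(x, 0)\<close>, so
  \<open>(x, 0)\<close> is a null vector, and the lower half of its image is \<open>G x\<close>.\<close>

lemma kernel_of_form_bound:
  fixes D G :: "'a::{real_normed_field,euclidean_space}^'n^'n"
  assumes D: "acts_self_adjoint D" and G: "acts_self_adjoint G"
    and form: "\<And>x y. 2 * ((G *v y) \<bullet> x) \<le> \<alpha> * ((norm (D *v x))\<^sup>2 + (norm (D *v y))\<^sup>2)"
    and x: "D *v x = 0"
  shows "G *v x = 0"
proof -
  let ?M = "bound_matrix \<alpha> D G"
  have "- (?M *v stack x 0) = 0"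
  proof (rule nonneg_form_null_vector[of "\<lambda>v. - (?M *v v)"])
    show "linear (\<lambda>v. - (?M *v v))"
      by (rule linear_compose_neg[OF matrix_action_linear])
    show "- (?M *v v) \<bullet> w = v \<bullet> - (?M *v w)" for v w
      using acts_self_adjointD[OF bound_matrix_acts_self_adjoint[OF D G]] by simp
    show "0 \<le> - (?M *v v) \<bullet> v" for v
    proof -
      obtain p q where "v = stack p q" by (rule stack_cases)
      with form[of q p] show ?thesis by (simp add: bound_matrix_form[OF D G])
    qed
    show "- (?M *v stack x 0) \<bullet> stack x 0 = 0"
      by (simp add: bound_matrix_form[OF D G] x)
  qed
  then show ?thesis
    by (simp add: bound_matrix_stack stack_eq_0_iff x)
qed

section \<open>Nonnegative diagonal matrices\<close>

definition real_diagonal :: "('n \<Rightarrow> real) \<Rightarrow> 'a::real_normed_field^'n^'n" where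
  "real_diagonal d = (\<chi> i j. if i = j then of_real (d i) else 0)"

lemma real_diagonal_mult_vec: "(real_diagonal d *v v) $ i = d i *\<^sub>R v $ i"
proof -
  have "(\<Sum>j\<in>UNIV. real_diagonal d $ i $ j * v $ j) =
      (\<Sum>j\<in>UNIV. if i = j then of_real (d i) * v $ j else 0)"
    by (rule sum.cong) (auto simp: real_diagonal_def)
  then show ?thesis
    by (simp add: matrix_vector_mult_def scaleR_conv_of_real)
qed

lemma real_diagonal_acts_self_adjoint: "acts_self_adjoint (real_diagonal d)"
  by (simp add: acts_self_adjoint_def inner_vec_def real_diagonal_mult_vec)

lemma unit_nonneg_diagonal_eq_real_diagonal:
  fixes D :: "'a::real_normed_field^'n^'n"
  assumes "unit_nonneg_diagonal D"
  obtains d where "D = real_diagonal d"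
proof -
  have "\<exists>r. D $ i $ i = of_real r" for i
    using assms by (auto simp: unit_nonneg_diagonal_def nonneg_Reals_def)
  then obtain d where "\<And>i. D $ i $ i = of_real (d i)" by metis
  with assms have "D = real_diagonal d"
    by (auto simp: unit_nonneg_diagonal_def real_diagonal_def vec_eq_iff)
  then show thesis by (rule that)
qed

section \<open>The criterion over a Euclidean field\<close>

text \<open>This is where the normalization of \<open>D\<close> matters. If \<open>D\<close> and \<open>G\<close> were \<open>0\<close>, the bound on the form
  would hold for every \<open>\<alpha>\<close>, whereas \<open>\<parallel>T\<parallel> \<le> \<alpha>\<close> is impossible for negative \<open>\<alpha>\<close>.\<close>

lemma form_bound_imp_nonneg:
  fixes D G :: "'a::{real_normed_field,euclidean_space}^'n^'n"
  assumes form: "\<And>x y. 2 * ((G *v y) \<bullet> x) \<le> \<alpha> * ((norm (D *v x))\<^sup>2 + (norm (D *v y))\<^sup>2)"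
    and "D \<noteq> 0"
  shows "0 \<le> \<alpha>"
proof -
  obtain x where "D *v x \<noteq> 0"
    using \<open>D \<noteq> 0\<close> by (metis matrix_eq matrix_vector_mult_0)
  then have "0 < (norm (D *v x))\<^sup>2" by simp
  moreover have "0 \<le> \<alpha> * (norm (D *v x))\<^sup>2"
    using form[of 0 x] linear_0[OF matrix_action_linear[of D]]
      linear_0[OF matrix_action_linear[of G]] by simp
  ultimately show ?thesis by (simp add: zero_le_mult_iff)
qed

text \<open>The factor is \<open>T = E G E\<close> with \<open>E\<close> the Moore-Penrose inverse of \<open>D\<close>. Since inverting gives
  \<open>0\<close> at \<open>0\<close>, \<open>E\<close> is the entrywise inverse of the diagonal, and \<open>D E = E D\<close> is the orthogonal
  projection onto the coordinates where \<open>D\<close> does not vanish. It fixes \<open>G\<close> on both sides because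
  \<open>G\<close> annihilates the kernel of \<open>D\<close>.\<close>

lemma factorization_of_form_bound:
  fixes D G :: "'a::{real_normed_field,euclidean_space}^'n^'n"
  assumes D_def: "D = real_diagonal d" and "D \<noteq> 0"
    and G: "acts_self_adjoint G"
    and form: "\<And>x y. 2 * ((G *v y) \<bullet> x) \<le> \<alpha> * ((norm (D *v x))\<^sup>2 + (norm (D *v y))\<^sup>2)"
  shows "\<exists>T. G = D ** T ** D \<and> spectral_norm T \<le> \<alpha>"
proof -
  define E :: "'a^'n^'n" where "E = real_diagonal (\<lambda>i. inverse (d i))"
  define T where "T = E ** G ** E"
  have D_sa: "acts_self_adjoint D" and E_sa: "acts_self_adjoint E"
    by (simp_all add: D_def E_def real_diagonal_acts_self_adjoint)
  have DED: "D *v (E *v (D *v x)) = D *v x" for x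
    by (auto simp: vec_eq_iff D_def E_def real_diagonal_mult_vec)
  have DE_ED: "D *v (E *v x) = E *v (D *v x)" for x
    by (simp add: vec_eq_iff D_def E_def real_diagonal_mult_vec)
  have T_vec: "T *v x = E *v (G *v (E *v x))" for x
    by (simp add: T_def matrix_vector_mul_assoc[symmetric])

  have GED: "G *v (E *v (D *v x)) = G *v x" for x
  proof -
    have "D *v (x - E *v (D *v x)) = 0"
      by (simp add: linear_diff[OF matrix_action_linear] DED)
    then have "G *v (x - E *v (D *v x)) = 0"
      by (rule kernel_of_form_bound[OF D_sa G form])
    then show ?thesis by (simp add: linear_diff[OF matrix_action_linear])
  qed
  have DEG: "D *v (E *v (G *v x)) = G *v x" for x
  proof -
    have "(D *v (E *v (G *v x))) \<bullet> y = (G *v x) \<bullet> y" for y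
      by (simp add: acts_self_adjointD[OF D_sa] acts_self_adjointD[OF E_sa]
          acts_self_adjointD[OF G] GED)
    then show ?thesis using vector_eq_rdot by blast
  qed
  have "(D ** T ** D) *v x = G *v x" for x
    by (simp add: matrix_vector_mul_assoc[symmetric] T_vec GED DEG)
  then have factor: "G = D ** T ** D" by (simp add: matrix_eq)

  have contract: "norm (D *v (E *v x)) \<le> norm x" for x
  proof (rule norm_le_componentwise_cart)
    fix i
    have "\<bar>d i * inverse (d i)\<bar> \<le> 1" by (cases "d i = 0") auto
    then show "norm ((D *v (E *v x)) $ i) \<le> norm (x $ i)"
      by (simp add: D_def E_def real_diagonal_mult_vec mult_left_le_one_le del: abs_mult)
  qed
  have "spectral_norm T \<le> \<alpha>"
  proof (rule spectral_norm_le_of_form_bound)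
    show "0 \<le> \<alpha>" using form \<open>D \<noteq> 0\<close> by (rule form_bound_imp_nonneg)
    fix x y
    have "2 * ((T *v y) \<bullet> x) = 2 * ((G *v (E *v y)) \<bullet> (E *v x))"
      by (simp add: T_vec acts_self_adjointD[OF E_sa])
    also have "\<dots> \<le> \<alpha> * ((norm (D *v (E *v x)))\<^sup>2 + (norm (D *v (E *v y)))\<^sup>2)"
      by (rule form)
    also have "\<dots> \<le> \<alpha> * ((norm x)\<^sup>2 + (norm y)\<^sup>2)"
      using \<open>0 \<le> \<alpha>\<close> by (intro mult_left_mono add_mono power_mono contract) auto
    finally show "2 * ((T *v y) \<bullet> x) \<le> \<alpha> * ((norm x)\<^sup>2 + (norm y)\<^sup>2)" .
  qed
  with factor show ?thesis by blast
qed

lemma factorization_bound_iff: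
  fixes D G :: "'a::{real_normed_field,euclidean_space}^'n^'n"
  assumes G: "acts_self_adjoint G" and D: "unit_nonneg_diagonal D"
  shows "(\<exists>T. G = D ** T ** D \<and> spectral_norm T \<le> \<alpha>) \<longleftrightarrow>
    lambda_max (bound_matrix \<alpha> D G) \<le> 0"
proof -
  obtain d where d: "D = real_diagonal d"
    using D by (rule unit_nonneg_diagonal_eq_real_diagonal)
  have D_sa: "acts_self_adjoint D"
    by (simp add: d real_diagonal_acts_self_adjoint)
  have "D \<noteq> 0"
    using D by (auto simp: unit_nonneg_diagonal_def trace_def matrix_matrix_mult_def)
  show ?thesis
    unfolding lambda_max_bound_matrix_nonpos_iff[OF D_sa G]
  proof
    assume "\<exists>T. G = D ** T ** D \<and> spectral_norm T \<le> \<alpha>"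
    then obtain T where G_eq: "G = D ** T ** D" and T: "spectral_norm T \<le> \<alpha>" by blast
    have "(G *v y) \<bullet> x = (T *v (D *v y)) \<bullet> (D *v x)" for x y
      by (simp add: G_eq matrix_vector_mul_assoc[symmetric] acts_self_adjointD[OF D_sa])
    then show "\<forall>x y. 2 * ((G *v y) \<bullet> x) \<le>
        \<alpha> * ((norm (D *v x))\<^sup>2 + (norm (D *v y))\<^sup>2)"
      using form_bound_of_spectral_norm_le[OF T] by simp
  next
    assume "\<forall>x y. 2 * ((G *v y) \<bullet> x) \<le> \<alpha> * ((norm (D *v x))\<^sup>2 + (norm (D *v y))\<^sup>2)"
    then show "\<exists>T. G = D ** T ** D \<and> spectral_norm T \<le> \<alpha>"
      using factorization_of_form_bound[OF d \<open>D \<noteq> 0\<close> G] by blast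
  qed
qed

theorem theorem5p5:
  fixes \<alpha> :: real
    and G :: "complex^'n^'n"
    and H :: "real^'n^'n"
  shows
    "(hermitian G \<longrightarrow>
       (\<forall>D :: complex^'n^'n. unit_nonneg_diagonal D \<longrightarrow>
          ((\<exists>T :: complex^'n^'n. G = D ** T ** D \<and> spectral_norm T \<le> \<alpha>)
            \<longleftrightarrow> lambda_max (bound_matrix \<alpha> D G) \<le> 0))
       \<and> ((\<nexists>D :: complex^'n^'n. unit_nonneg_diagonal D \<and> lambda_max (bound_matrix \<alpha> D G) \<le> 0) \<longrightarrow>
          (\<nexists>(D :: complex^'n^'n) (T :: complex^'n^'n).
             unit_nonneg_diagonal D \<and> G = D ** T ** D \<and> spectral_norm T \<le> \<alpha>)))
     \<and>
     (transpose H = H \<longrightarrow>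
       (\<forall>D :: real^'n^'n. unit_nonneg_diagonal D \<longrightarrow>
          ((\<exists>T :: real^'n^'n. H = D ** T ** D \<and> spectral_norm T \<le> \<alpha>)
            \<longleftrightarrow> lambda_max (bound_matrix \<alpha> D H) \<le> 0))
       \<and> ((\<nexists>D :: real^'n^'n. unit_nonneg_diagonal D \<and> lambda_max (bound_matrix \<alpha> D H) \<le> 0) \<longrightarrow>
          (\<nexists>(D :: real^'n^'n) (T :: real^'n^'n).
             unit_nonneg_diagonal D \<and> H = D ** T ** D \<and> spectral_norm T \<le> \<alpha>)))"
proof -
  have "(\<exists>T. G = D ** T ** D \<and> spectral_norm T \<le> \<alpha>) \<longleftrightarrow> lambda_max (bound_matrix \<alpha> D G) \<le> 0"
    if "hermitian G" "unit_nonneg_diagonal D" for D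
    using that hermitian_acts_self_adjoint factorization_bound_iff by blast
  moreover
  have "(\<exists>T. H = D ** T ** D \<and> spectral_norm T \<le> \<alpha>) \<longleftrightarrow> lambda_max (bound_matrix \<alpha> D H) \<le> 0"
    if "transpose H = H" "unit_nonneg_diagonal D" for D
    using that symmetric_acts_self_adjoint factorization_bound_iff by blast
  ultimately show ?thesis by blast
qed

end
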